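(* The numbers of parking functions of $1,\ldots,n$ for which the third, fourth, and fifth spots, respectively, are lucky are given by \begin{align*} \sum_{i=1}^nq_n(i,3)&=\tfrac23(n+1)^{n-1}-\tfrac13(2n-1)(n-2)^{n-2} &&\text{for } n\ge 3,\\ \sum_{i=1}^nq_n(i,4)&=\tfrac58(n+1)^{n-1}-\tfrac18(13n^2-26n+9)(n-3)^{n-3} &&\text{for } n\ge 4,\\ \sum_{i=1}^nq_n(i,5)&=\tfrac35(n+1)^{n-1}-\tfrac1{30}(118n^3-531n^2+659n-192)(n-4)^{n-4} &&\text{for } n\ge 5. \end{align*}
   Context: There are $n$ spots labeled $1,\ldots,n$ in order along a one-way street, and $n$ cars entering one after another, car $i$ having preference $a_i\in\{1,\ldots,n\}$. Each car drives to its preferred spot and parks there if it is available; otherwise it moves forward and parks in the first available later spot, if any (if none, it fails to park). A parking function of $1,\ldots,n$ is a sequence of preferences $(a_1,\ldots,a_n)$ such that all $n$ cars are able to park. A car is lucky if it parks in its preferred spot; a spot is lucky if the car that parks in it prefers that spot. For $1\le i,j\le n$, $q_n(i,j)$ denotes the number of parking functions of $1,\ldots,n$ in which the $i$-th car prefers the $j$-th spot and the $i$-th car is lucky. *)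

theory Defs
  imports Complex_Main
begin

text \<open>
  A preference sequence is a list over \<open>{1..n}\<close>. Cars and spots are numbered from 1, so car \<open>i\<close>
  has preference \<open>a ! (i - 1)\<close>. The value \<open>None\<close> means that the car fails to park.
\<close>

definition parking_spot :: "nat \<Rightarrow> nat set \<Rightarrow> nat \<Rightarrow> nat option" where
  "parking_spot n occupied p =
     (if \<exists>s\<in>{p..n}. s \<notin> occupied then Some (LEAST s. s \<in> {p..n} \<and> s \<notin> occupied) else None)"

fun park_from :: "nat \<Rightarrow> nat set \<Rightarrow> nat list \<Rightarrow> nat option list" where
  "park_from n occupied [] = []"
| "park_from n occupied (p # ps) =
     (let s = parking_spot n occupied p in s # park_from n (occupied \<union> set_option s) ps)"

definition outcome :: "nat \<Rightarrow> nat list \<Rightarrow> nat option list" where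
  "outcome n a = park_from n {} a"

definition parking_function :: "nat \<Rightarrow> nat list \<Rightarrow> bool" where
  "parking_function n a \<longleftrightarrow> length a = n \<and> set a \<subseteq> {1..n} \<and> None \<notin> set (outcome n a)"

definition lucky_car :: "nat \<Rightarrow> nat list \<Rightarrow> nat \<Rightarrow> bool" where
  "lucky_car n a i \<longleftrightarrow> outcome n a ! (i - 1) = Some (a ! (i - 1))"

definition lucky_spot :: "nat \<Rightarrow> nat list \<Rightarrow> nat \<Rightarrow> bool" where
  "lucky_spot n a j \<longleftrightarrow> (\<exists>i\<in>{1..n}. outcome n a ! (i - 1) = Some j \<and> a ! (i - 1) = j)"

definition q :: "nat \<Rightarrow> nat \<Rightarrow> nat \<Rightarrow> nat" where
  "q n i j = card {a. parking_function n a \<and> a ! (i - 1) = j \<and> lucky_car n a i}"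

definition num_lucky_spot :: "nat \<Rightarrow> nat \<Rightarrow> nat" where
  "num_lucky_spot n j = card {a. parking_function n a \<and> lucky_spot n a j}"

end

theory Submission
  imports Defs
begin

text \<open>
  Spot \<open>j\<close> is lucky iff some car prefers it and the cars arriving before the first such car with
  preferences below \<open>j\<close> all fit into the spots \<open>1..j-1\<close>. So luckiness depends only on the
  subword \<open>u\<close> of preferences at most \<open>j\<close>, while the parking condition splits into one on \<open>u\<close>
  (it fills \<open>1..j\<close>) and one on the remaining preferences (they fit into \<open>j+1..n\<close>).

  Among all words of length \<open>m \<ge> j\<close> over \<open>1..j\<close>, exactly \<open>(j+1)/(2j) * j^m\<close> are lucky at \<open>j\<close>.
  Removing those that leave a spot empty, classified by the smallest empty spot \<open>k+1\<close>, expresses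
  the number \<open>W(m)\<close> of lucky filling words as \<open>(j+1)/(2j) * j^m\<close> minus multiples of
  \<open>C(m,k) * (j-1-k)^(m-k)\<close>. The number of lucky parking functions is the sum over \<open>m \<ge> j\<close> of
  \<open>C(n,m) * W(m) * (m-j+1) * (n-j+1)^(n-m-1)\<close>. Extending the sum to all \<open>m \<le> n\<close>, each of these
  correction terms contributes 0 and \<open>j^m\<close> contributes \<open>(n+1)^(n-1)\<close>; what is left is the finite
  correction from \<open>m < j - 1\<close>.
\<close>

section \<open>Parking and luckiness as conditions on preference counts\<close>

definition words :: "'a set \<Rightarrow> nat \<Rightarrow> 'a list set" where
  "words A m = {w. set w \<subseteq> A \<and> length w = m}"

text \<open>
  \<open>fits N X w\<close> says that, when the spots in \<open>X\<close> are taken, all cars with preferences \<open>w\<close> can park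
  in \<open>1..N\<close> (see \<open>all_park_iff_fits\<close>).
\<close>

definition fits :: "nat \<Rightarrow> nat set \<Rightarrow> nat list \<Rightarrow> bool" where
  "fits N X w \<longleftrightarrow> (\<forall>s\<le>N. length (filter (\<lambda>x. s < x) w) \<le> card ({s+1..N} - X))"

definition lucky_word :: "nat \<Rightarrow> nat list \<Rightarrow> bool" where
  "lucky_word j w \<longleftrightarrow> j \<in> set w \<and> fits (j - 1) {} (filter (\<lambda>x. x < j) (takeWhile (\<lambda>x. x \<noteq> j) w))"

text \<open>For words over \<open>1..j\<close> this says that every spot of \<open>1..j\<close> ends
  up occupied. The word may be longer than \<open>j\<close>; the surplus cars drive on past
  \<open>j\<close>.\<close>

definition fills :: "nat \<Rightarrow> nat list \<Rightarrow> bool" where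
  "fills j w \<longleftrightarrow> (\<forall>s\<le>j. s \<le> length (filter (\<lambda>x. x \<le> s) w))"

lemma finite_words [simp]: "finite A \<Longrightarrow> finite (words A m)"
  by (simp add: words_def finite_lists_length_eq)

lemma length_filter_mono:
  "(\<And>x. P x \<Longrightarrow> Q x) \<Longrightarrow> length (filter P w) \<le> length (filter Q w)"
  by (induction w) auto

section \<open>The parking process and its capacity condition\<close>

lemma parking_spot_eq_None: "parking_spot n X p = None \<longleftrightarrow> {p..n} \<subseteq> X"
  by (auto simp: parking_spot_def)

lemma parking_spot_eq_Some:
  "parking_spot n X p = Some t \<longleftrightarrow> t \<in> {p..n} \<and> t \<notin> X \<and> {p..<t} \<subseteq> X"
proof
  assume h: "parking_spot n X p = Some t"
  then have ex: "\<exists>s. s \<in> {p..n} \<and> s \<notin> X" and t: "t = (LEAST s. s \<in> {p..n} \<and> s \<notin> X)"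
    by (auto simp: parking_spot_def split: if_splits)
  have 1: "t \<in> {p..n} \<and> t \<notin> X" unfolding t by (rule LeastI_ex[OF ex])
  moreover have "s \<in> X" if "s \<in> {p..<t}" for s
    using not_less_Least[of s "\<lambda>s. s \<in> {p..n} \<and> s \<notin> X"] that 1 t by auto
  ultimately show "t \<in> {p..n} \<and> t \<notin> X \<and> {p..<t} \<subseteq> X" by blast
next
  assume h: "t \<in> {p..n} \<and> t \<notin> X \<and> {p..<t} \<subseteq> X"
  have "(LEAST s. s \<in> {p..n} \<and> s \<notin> X) = t"
    using h by (intro Least_equality) (auto simp: subset_iff not_le[symmetric])
  with h show "parking_spot n X p = Some t" by (auto simp: parking_spot_def)
qed

lemma fits_insert_outside: "N < t \<Longrightarrow> fits N (insert t X) w \<longleftrightarrow> fits N X w"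
proof -
  assume "N < t"
  then have "{s+1..N} - insert t X = {s+1..N} - X" for s by auto
  then show ?thesis by (simp add: fits_def)
qed

text \<open>One step of the parking process. Occupying \<open>t\<close> lowers the capacity beyond
  \<open>s\<close> exactly for \<open>s < t\<close>, while dropping \<open>p\<close> lowers the
  demand exactly for \<open>s < p\<close>. The gap \<open>p \<le> s < t\<close> is harmless because
  the spots \<open>{p..<t}\<close> are already occupied.\<close>

lemma fits_Cons:
  assumes "1 \<le> p"
  shows "fits N X (p # w) \<longleftrightarrow> (\<exists>t. parking_spot N X p = Some t \<and> fits N (insert t X) w)"
proof (cases "parking_spot N X p")
  case None
  \<comment> \<open>The witness against \<open>fits\<close>: no spot beyond \<open>s\<close> is
    free, yet the first car wants one. The minimum covers \<open>p > N\<close>.\<close>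
  define s where "s = min (p - 1) N"
  have "{s+1..N} - X = {}"
    using None assms by (auto simp: parking_spot_eq_None s_def subset_iff min_def split: if_splits)
  moreover have "s \<le> N" "s < p" using assms by (auto simp: s_def)
  ultimately have "\<not> length (filter (\<lambda>x. s < x) (p # w)) \<le> card ({s+1..N} - X)" by (simp only: card.empty) simp
  with \<open>s \<le> N\<close> have "\<not> fits N X (p # w)" unfolding fits_def by blast
  with None show ?thesis by simp
next
  case (Some t)
  then have t: "p \<le> t" "t \<le> N" "t \<notin> X" "{p..<t} \<subseteq> X" by (auto simp: parking_spot_eq_Some)
  let ?f = "\<lambda>s. card ({s+1..N} - X)" and ?g = "\<lambda>s. card ({s+1..N} - insert t X)"
  let ?l = "\<lambda>s. length (filter (\<lambda>x. s < x) w)"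
  have lt: "?f s = Suc (?g s)" if "s < t" for s
  proof -
    have "{s+1..N} - insert t X = {s+1..N} - X - {t}" by auto
    moreover have "Suc (card ({s+1..N} - X - {t})) = ?f s"
      using that t by (intro card_Suc_Diff1) auto
    ultimately show ?thesis by (simp only:)
  qed
  have ge: "?f s = ?g s" if "t \<le> s" for s
  proof -
    have "{s+1..N} - insert t X = {s+1..N} - X" using that by auto
    then show ?thesis by (simp only:)
  qed
  \<comment> \<open>No spot of \<open>p..s\<close> is free, so the capacity beyond \<open>s\<close>
    equals that beyond \<open>p - 1\<close>, whereas the demand can only shrink.\<close>
  have between: "?l s \<le> ?g s" if "?l (p - 1) \<le> ?g (p - 1)" "p \<le> s" "s < t" for s
  proof -
    have "{p..s} \<subseteq> X" using that t by auto
    moreover have "{p - 1 + 1..N} = {p..s} \<union> {s + 1..N}" using that t assms by auto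
    ultimately have "{s+1..N} - X = {p - 1 + 1..N} - X" by blast
    then have "?f s = ?f (p - 1)" by (simp only:)
    then have "?g s = ?g (p - 1)" using lt that t assms by simp
    moreover have "?l s \<le> ?l (p - 1)"
      using that by (intro length_filter_mono) auto
    ultimately show ?thesis using that by simp
  qed
  have "fits N X (p # w) \<longleftrightarrow> fits N (insert t X) w"
  proof
    assume h: "fits N X (p # w)"
    have p: "?l (p - 1) \<le> ?g (p - 1)"
    proof -
      have "length (filter (\<lambda>x. p - 1 < x) (p # w)) \<le> ?f (p - 1)"
        using h t unfolding fits_def by (metis diff_le_self le_trans)
      moreover have "length (filter (\<lambda>x. p - 1 < x) (p # w)) = Suc (?l (p - 1))" using assms by simp
      moreover have "?f (p - 1) = Suc (?g (p - 1))" using t assms by (intro lt) auto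
      ultimately show ?thesis by linarith
    qed
    show "fits N (insert t X) w" unfolding fits_def
    proof (intro allI impI)
      fix s assume s: "s \<le> N"
      have "length (filter (\<lambda>x. s < x) (p # w)) \<le> ?f s" using h s by (simp only: fits_def)
      then show "?l s \<le> ?g s" using lt[of s] ge[of s] between[OF p, of s] t
        by (cases "s < p"; cases "s < t") auto
    qed
  next
    assume h: "fits N (insert t X) w"
    show "fits N X (p # w)" unfolding fits_def
    proof (intro allI impI)
      fix s assume s: "s \<le> N"
      have "?l s \<le> ?g s" using h s by (simp only: fits_def)
      then show "length (filter (\<lambda>x. s < x) (p # w)) \<le> ?f s" using lt[of s] ge[of s] t
        by (cases "s < p"; cases "s < t") auto
    qed
  qed
  with Some show ?thesis by simp
qed

lemma all_park_iff_fits: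
  "0 \<notin> set a \<Longrightarrow> None \<notin> set (park_from n X a) \<longleftrightarrow> fits n X a"
proof (induction a arbitrary: X)
  case Nil
  then show ?case by (simp add: fits_def)
next
  case (Cons p a)
  then show ?case
    by (cases "parking_spot n X p") (auto simp: fits_Cons Let_def)
qed

lemma length_park_from [simp]: "length (park_from n X a) = length a"
  by (induction a arbitrary: X) (auto simp: Let_def)

lemma park_from_avoids: "t \<in> X \<Longrightarrow> Some t \<notin> set (park_from n X a)"
proof (induction a arbitrary: X)
  case (Cons p a)
  then have "parking_spot n X p \<noteq> Some t" by (simp add: parking_spot_eq_Some)
  then show ?case using Cons by (auto simp: Let_def)
qed simp

text \<open>A taken spot stays in the occupied set, so by \<open>park_from_avoids\<close> no later
  car gets it. This makes the events counted by \<open>q n i j\<close> disjoint for different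
  \<open>i\<close>.\<close>

lemma park_from_unique:
  assumes "park_from n X a ! i = Some t" "park_from n X a ! i' = Some t"
    "i < length a" "i' < length a"
  shows "i = i'"
  using assms
proof (induction a arbitrary: X i i')
  case Nil
  then show ?case by simp
next
  case (Cons p a)
  have *: "park_from n (insert t X) a ! k \<noteq> Some t" if "k < length a" for k
    using park_from_avoids[of t "insert t X" n a] that by (metis insertI1 length_park_from nth_mem)
  show ?case
    using Cons.prems *
    by (cases i; cases i') (auto simp: Let_def intro: Cons.IH)
qed

text \<open>Induction over the arriving cars, with arbitrary occupied spots. The first car
  preferring \<open>j\<close> decides. Cars preferring a later spot never touch \<open>1..j\<close>;
  a car preferring \<open>p < j\<close> either parks below \<open>j\<close> or overflows and costs
  spot \<open>j\<close>. Zipping preferences with outcomes avoids car indices.\<close>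

lemma lucky_from_iff:
  assumes "0 \<notin> set a" "1 \<le> j" "j \<le> n"
  shows "(j, Some j) \<in> set (zip a (park_from n X a)) \<longleftrightarrow>
    j \<notin> X \<and> j \<in> set a \<and> fits (j - 1) X (filter (\<lambda>x. x < j) (takeWhile (\<lambda>x. x \<noteq> j) a))"
  using assms(1)
proof (induction a arbitrary: X)
  case Nil
  then show ?case by simp
next
  case (Cons p a)
  let ?s = "parking_spot n X p"
  let ?w = "filter (\<lambda>x. x < j) (takeWhile (\<lambda>x. x \<noteq> j) a)"
  have IH: "(j, Some j) \<in> set (zip a (park_from n (X \<union> set_option ?s) a)) \<longleftrightarrow>
    j \<notin> X \<union> set_option ?s \<and> j \<in> set a \<and> fits (j - 1) (X \<union> set_option ?s) ?w"
    using Cons by auto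
  have step: "(j, Some j) \<in> set (zip (p # a) (park_from n X (p # a))) \<longleftrightarrow>
    (p = j \<and> ?s = Some j) \<or> (j, Some j) \<in> set (zip a (park_from n (X \<union> set_option ?s) a))"
    by (auto simp: Let_def)
  consider "p = j" | "p > j" | "p < j" by linarith
  then show ?case
  proof cases
    case 1
    have "?s = Some j \<longleftrightarrow> j \<notin> X" using 1 assms by (auto simp: parking_spot_eq_Some)
    then show ?thesis unfolding step IH using 1 by (auto simp: fits_def)
  next
    case 2
    have "X \<union> set_option ?s = X \<or> (\<exists>t>j. X \<union> set_option ?s = insert t X)"
    proof (cases ?s)
      case (Some t)
      then have "j < t" using 2 by (auto simp: parking_spot_eq_Some)
      with Some show ?thesis by auto
    qed simp
    then have "fits (j - 1) (X \<union> set_option ?s) ?w = fits (j - 1) X ?w"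
      "j \<in> X \<union> set_option ?s \<longleftrightarrow> j \<in> X"
      by (auto simp: fits_insert_outside)
    then show ?thesis unfolding step IH using 2 by auto
  next
    case 3
    have p: "1 \<le> p" using Cons.prems by (cases p) auto
    show ?thesis
    proof (cases "parking_spot (j - 1) X p")
      case None
      \<comment> \<open>With no free spot in \<open>p..j-1\<close>, the car takes \<open>j\<close>
        unless it is already occupied; either way \<open>j\<close> is lost.\<close>
      then have "?s = Some j" if "j \<notin> X"
        using that 3 assms by (auto simp: parking_spot_eq_None parking_spot_eq_Some subset_iff)
      then have "j \<in> X \<union> set_option ?s" by (cases "j \<in> X") auto
      then show ?thesis unfolding step IH using 3 None p by (auto simp: fits_Cons)
    next
      case (Some t)
      then have "?s = Some t" "t < j" using assms by (auto simp: parking_spot_eq_Some)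
      then show ?thesis unfolding step IH using 3 Some p by (auto simp: fits_Cons)
    qed
  qed
qed

lemma lucky_spot_iff_lucky_word:
  assumes "length a = n" "set a \<subseteq> {1..n}" "1 \<le> j" "j \<le> n"
  shows "lucky_spot n a j \<longleftrightarrow> lucky_word j a"
proof -
  have "lucky_spot n a j \<longleftrightarrow> (\<exists>i<n. park_from n {} a ! i = Some j \<and> a ! i = j)"
    (is "?l \<longleftrightarrow> (\<exists>i<n. ?P i)")
  proof -
    have "(\<exists>i\<in>{1..n}. P (i - 1)) \<longleftrightarrow> (\<exists>i<n. P i)" for P :: "nat \<Rightarrow> bool"
    proof -
      have "{..<n} = (\<lambda>i. i - 1) ` {1..n}"
        by (auto simp: image_iff intro!: bexI[of _ "Suc x" for x])
      then have "(\<exists>i\<in>{..<n}. P i) \<longleftrightarrow> (\<exists>i\<in>{1..n}. P (i - 1))" by (simp only: bex_simps)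
      then show ?thesis by auto
    qed
    then show ?thesis by (simp only: lucky_spot_def outcome_def)
  qed
  also have "\<dots> \<longleftrightarrow> (j, Some j) \<in> set (zip a (park_from n {} a))"
    using assms(1) by (force simp: set_zip)
  also have "\<dots> \<longleftrightarrow> lucky_word j a"
    using assms by (subst lucky_from_iff) (auto simp: lucky_word_def)
  finally show ?thesis .
qed

lemma parking_function_iff_fits:
  "parking_function n a \<longleftrightarrow> a \<in> words {1..n} n \<and> fits n {} a"
proof -
  have "set a \<subseteq> {1..n} \<Longrightarrow> 0 \<notin> set a" by auto
  then show ?thesis
    using all_park_iff_fits[of a n "{}"] by (auto simp: parking_function_def words_def outcome_def)
qed

lemma finite_parking_functions: "finite {a. parking_function n a \<and> P a}"
  by (rule finite_subset[of _ "words {1..n} n"]) (auto simp: parking_function_iff_fits)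

text \<open>At most one car parks in spot \<open>j\<close>, so the parking functions with
  \<open>j\<close> lucky split according to the car that parks there.\<close>

lemma num_lucky_spot_eq_sum_q: "num_lucky_spot n j = (\<Sum>i=1..n. q n i j)"
proof -
  let ?A = "\<lambda>i. {a. parking_function n a \<and> a ! (i - 1) = j \<and> lucky_car n a i}"
  have "{a. parking_function n a \<and> lucky_spot n a j} = (\<Union>i\<in>{1..n}. ?A i)"
    by (auto simp: lucky_spot_def lucky_car_def)
  moreover have "card (\<Union>i\<in>{1..n}. ?A i) = (\<Sum>i=1..n. card (?A i))"
  proof (rule card_UN_disjoint)
    show "\<forall>i\<in>{1..n}. \<forall>i'\<in>{1..n}. i \<noteq> i' \<longrightarrow> ?A i \<inter> ?A i' = {}"
    proof (intro ballI impI equals0I)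
      fix i i' a assume h: "i \<in> {1..n}" "i' \<in> {1..n}" "i \<noteq> i'" "a \<in> ?A i \<inter> ?A i'"
      then have "i - 1 = i' - 1"
        by (intro park_from_unique[of n "{}" a _ j])
          (auto simp: lucky_car_def outcome_def parking_function_def)
      then show False using h by auto
    qed
  qed (auto intro: finite_parking_functions)
  ultimately show ?thesis by (simp add: num_lucky_spot_def q_def)
qed

section \<open>Counting words\<close>

lemma card_words_Cons:
  assumes "finite A"
  shows "card {w \<in> words A (Suc m). P w} = (\<Sum>x\<in>A. card {w \<in> words A m. P (x # w)})"
proof -
  have "{w \<in> words A (Suc m). P w} = (\<Union>x\<in>A. (#) x ` {w \<in> words A m. P (x # w)})"
    by (auto simp: words_def length_Suc_conv)
  also have "card \<dots> = (\<Sum>x\<in>A. card ((#) x ` {w \<in> words A m. P (x # w)}))"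
    using assms by (intro card_UN_disjoint) auto
  also have "\<dots> = (\<Sum>x\<in>A. card {w \<in> words A m. P (x # w)})"
    by (intro sum.cong refl card_image) auto
  finally show ?thesis .
qed

lemma card_words_snoc:
  assumes "finite A"
  shows "card {w \<in> words A (Suc m). P w} = (\<Sum>y\<in>A. card {w \<in> words A m. P (w @ [y])})"
proof -
  have "{w \<in> words A (Suc m). P w} = (\<Union>y\<in>A. (\<lambda>w. w @ [y]) ` {w \<in> words A m. P (w @ [y])})"
    by (auto simp: words_def length_Suc_conv_rev)
  also have "card \<dots> = (\<Sum>y\<in>A. card ((\<lambda>w. w @ [y]) ` {w \<in> words A m. P (w @ [y])}))"
    using assms by (intro card_UN_disjoint) auto
  also have "\<dots> = (\<Sum>y\<in>A. card {w \<in> words A m. P (w @ [y])})"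
    by (intro sum.cong refl card_image) (auto simp: inj_on_def)
  finally show ?thesis .
qed

text \<open>Pascal's rule in summed form, for the induction step of
  \<open>card_words_filter_split\<close>.\<close>

lemma sum_binomial_Suc:
  fixes f :: "nat \<Rightarrow> nat"
  shows "(\<Sum>m\<le>Suc n. (Suc n choose m) * f m) =
    (\<Sum>m\<le>n. (n choose m) * f (Suc m)) + (\<Sum>m\<le>n. (n choose m) * f m)"
proof -
  have "(\<Sum>m\<le>n. (n choose m) * f m) = (\<Sum>m\<le>Suc n. (n choose m) * f m)" by simp
  also have "\<dots> = f 0 + (\<Sum>m\<le>n. (n choose Suc m) * f (Suc m))"
    by (subst sum.atMost_Suc_shift) simp
  finally show ?thesis
    by (subst sum.atMost_Suc_shift) (simp add: algebra_simps sum.distrib)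
qed

text \<open>A word is determined by its two subwords and the positions of the letters satisfying
  \<open>R\<close>; the binomial coefficient counts the position sets. In the induction the first
  letter joins one of the subwords, which changes \<open>P\<close> or \<open>Q\<close>, so both are
  kept arbitrary.\<close>

lemma card_words_filter_split:
  assumes "finite S"
  shows "card {w \<in> words S n. P (filter R w) \<and> Q (filter (\<lambda>x. \<not> R x) w)} =
    (\<Sum>m\<le>n. (n choose m) * (card {u \<in> words {x \<in> S. R x} m. P u} *
                            card {v \<in> words {x \<in> S. \<not> R x} (n - m). Q v}))"
proof (induction n arbitrary: P Q)
  case 0
  have "words T 0 = {[]}" for T :: "'a set" by (auto simp: words_def)
  then show ?case by (auto simp: Collect_conv_if)
next
  case (Suc n)
  let ?A = "{x \<in> S. R x}" and ?B = "{x \<in> S. \<not> R x}"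
  let ?c = "\<lambda>A m P. card {u \<in> words A m. P u}"
  let ?split = "\<lambda>P Q n. \<Sum>m\<le>n. (n choose m) * (?c ?A m P * ?c ?B (n - m) Q)"
  have fin: "finite ?A" "finite ?B" using assms by auto
  have "?c S (Suc n) (\<lambda>w. P (filter R w) \<and> Q (filter (\<lambda>x. \<not> R x) w)) =
    (\<Sum>x\<in>S. ?c S n (\<lambda>w. P (filter R (x # w)) \<and> Q (filter (\<lambda>x. \<not> R x) (x # w))))"
    using assms by (rule card_words_Cons)
  also have "\<dots> = (\<Sum>x\<in>?A. ?c S n (\<lambda>w. P (x # filter R w) \<and> Q (filter (\<lambda>x. \<not> R x) w))) +
    (\<Sum>x\<in>?B. ?c S n (\<lambda>w. P (filter R w) \<and> Q (x # filter (\<lambda>x. \<not> R x) w)))"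
  proof -
    have "S = ?A \<union> ?B" "?A \<inter> ?B = {}" by auto
    then have "sum f S = sum f ?A + sum f ?B" for f :: "'a \<Rightarrow> nat"
      using fin by (metis sum.union_disjoint)
    then show ?thesis by simp
  qed
  also have "\<dots> = (\<Sum>x\<in>?A. ?split (\<lambda>u. P (x # u)) Q n) + (\<Sum>x\<in>?B. ?split P (\<lambda>v. Q (x # v)) n)"
    by (intro arg_cong2[of _ _ _ _ "(+)"] sum.cong refl; subst Suc.IH; rule refl)
  also have "(\<Sum>x\<in>?A. ?split (\<lambda>u. P (x # u)) Q n) =
    (\<Sum>m\<le>n. (n choose m) * (?c ?A (Suc m) P * ?c ?B (n - m) Q))"
    by (subst sum.swap) (simp add: card_words_Cons[OF fin(1)] sum_distrib_left sum_distrib_right)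
  also have "(\<Sum>x\<in>?B. ?split P (\<lambda>v. Q (x # v)) n) =
    (\<Sum>m\<le>n. (n choose m) * (?c ?A m P * ?c ?B (Suc (n - m)) Q))"
    by (subst sum.swap) (simp add: card_words_Cons[OF fin(2)] sum_distrib_left sum_distrib_right)
  also have "\<dots> = (\<Sum>m\<le>n. (n choose m) * (?c ?A m P * ?c ?B (Suc n - m) Q))"
    by (intro sum.cong refl) (simp add: Suc_diff_le)
  also have "(\<Sum>m\<le>n. (n choose m) * (?c ?A (Suc m) P * ?c ?B (n - m) Q)) + \<dots> = ?split P Q (Suc n)"
    using sum_binomial_Suc[of n "\<lambda>m. ?c ?A m P * ?c ?B (Suc n - m) Q"] by simp
  finally show ?case .
qed

text \<open>The binomial theorem combined with the absorption identity for \<open>m\<close> times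
  \<open>n choose m\<close>. The factor \<open>x + s\<close> avoids the exponent
  \<open>n - 1\<close>, so neither \<open>n = 0\<close> nor \<open>x + s = 0\<close> is
  exceptional.\<close>

lemma sum_binomial_linear:
  fixes x s c :: real
  shows "(x + s) * (\<Sum>m\<le>n. real (n choose m) * (real m - c) * s ^ m * x ^ (n - m)) =
    (real n * s - c * (x + s)) * (x + s) ^ n"
proof -
  have lin: "(x + s) * (\<Sum>m\<le>n. real m * real (n choose m) * s ^ m * x ^ (n - m)) = real n * s * (x + s) ^ n"
  proof (cases n)
    case (Suc k)
    have "(\<Sum>m\<le>n. real m * real (n choose m) * s ^ m * x ^ (n - m)) =
      (\<Sum>m\<le>k. real (Suc m * (Suc k choose Suc m)) * s ^ Suc m * x ^ (k - m))"
      unfolding Suc by (subst sum.atMost_Suc_shift) (simp add: algebra_simps del: binomial_Suc_Suc)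
    also have "\<dots> = real n * s * (\<Sum>m\<le>k. real (k choose m) * s ^ m * x ^ (k - m))"
      unfolding Suc_times_binomial Suc sum_distrib_left
      by (intro sum.cong refl) (simp add: algebra_simps)
    also have "\<dots> = real n * s * (s + x) ^ k" by (simp only: binomial_ring)
    finally show ?thesis by (simp add: Suc add.commute)
  qed simp
  have "(\<Sum>m\<le>n. real (n choose m) * (real m - c) * s ^ m * x ^ (n - m)) =
    (\<Sum>m\<le>n. real m * real (n choose m) * s ^ m * x ^ (n - m)) -
    c * (\<Sum>m\<le>n. real (n choose m) * s ^ m * x ^ (n - m))"
    unfolding sum_distrib_left sum_subtractf[symmetric]
    by (intro sum.cong refl) (simp add: algebra_simps)
  also have "(\<Sum>m\<le>n. real (n choose m) * s ^ m * x ^ (n - m)) = (x + s) ^ n"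
    by (subst add.commute) (simp only: binomial_ring)
  finally show ?thesis by (simp only: right_diff_distrib lin) (simp add: algebra_simps)
qed

section \<open>Parking functions of r cars on a segment of N - i spots\<close>

definition num_fits :: "nat \<Rightarrow> nat \<Rightarrow> nat \<Rightarrow> nat" where
  "num_fits i N r = card {v \<in> words {i+1..N} r. fits N {} v}"

lemma num_fits_eq_0:
  assumes "i \<le> N" "N - i < r"
  shows "num_fits i N r = 0"
proof -
  have "\<not> fits N {} v" if "v \<in> words {i+1..N} r" for v
  proof -
    have "filter (\<lambda>x. i < x) v = v" "length v = r" using that by (auto simp: words_def filter_id_conv)
    then show ?thesis using assms unfolding fits_def not_all by (intro exI[of _ i]) simp
  qed
  then show ?thesis by (auto simp: num_fits_def)
qed

text \<open>
  Multiplied by \<open>d + 1\<close> to avoid the exponent \<open>r - 1\<close>; includes the case \<open>r = d + 1\<close>, where both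
  sides vanish, as needed in the induction, which splits off the cars preferring the first spot.
\<close>

lemma num_fits_formula:
  assumes "r \<le> d + 1"
  shows "real (num_fits i (i + d) r) * (real d + 1) = (real d + 1 - real r) * (real d + 1) ^ r"
  using assms
proof (induction d arbitrary: i r)
  case 0
  show ?case
  proof (cases r)
    case 0
    have "{v \<in> words {i+1..i+0} 0. fits (i+0) {} v} = {[]}" by (auto simp: words_def fits_def)
    then show ?thesis by (simp add: num_fits_def 0)
  next
    case (Suc k)
    then have "r = 1" using \<open>r \<le> 0 + 1\<close> by simp
    then show ?thesis by (simp add: num_fits_eq_0)
  qed
next
  case (Suc d)
  define N where "N = i + Suc d"
  define D where "D = real d + 1"
  have D: "D > 0" by (simp add: D_def)
  show ?case
  proof (cases "r \<le> d + 1")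
    case False
    then have "r = d + 2" using Suc.prems by simp
    then show ?thesis by (simp add: num_fits_eq_0)
  next
    case True
    have fits_filter: "fits N {} w \<longleftrightarrow> fits N {} (filter (\<lambda>x. \<not> x \<le> Suc i) w)" if "length w = r" for w
    proof -
      have "length (filter (\<lambda>x. s < x) w) \<le> N - s" if "s \<le> i" for s
        using length_filter_le[of "\<lambda>x. s < x" w] that \<open>length w = r\<close> True by (simp add: N_def)
      moreover have "filter (\<lambda>x. s < x) (filter (\<lambda>x. \<not> x \<le> Suc i) w) = filter (\<lambda>x. s < x) w" if "i < s" for s
        using that by (auto intro!: filter_cong simp: filter_filter)
      moreover have "length (filter (\<lambda>x. s < x) (filter (\<lambda>x. \<not> x \<le> Suc i) w)) \<le> length (filter (\<lambda>x. s < x) w)" for s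
        unfolding filter_filter by (rule length_filter_mono) auto
      ultimately show ?thesis unfolding fits_def
        by (simp add: not_less) (metis le_trans not_le)
    qed
    have "num_fits i N r = card {w \<in> words {i+1..N} r. True \<and> fits N {} (filter (\<lambda>x. \<not> x \<le> Suc i) w)}"
      unfolding num_fits_def by (intro arg_cong[of _ _ card] Collect_cong) (auto simp: words_def fits_filter[symmetric])
    also have "\<dots> = (\<Sum>m\<le>r. (r choose m) * (card {u \<in> words {x \<in> {i+1..N}. x \<le> Suc i} m. True} *
      card {v \<in> words {x \<in> {i+1..N}. \<not> x \<le> Suc i} (r - m). fits N {} v}))"
      by (rule card_words_filter_split) simp
    also have "\<dots> = (\<Sum>m\<le>r. (r choose m) * num_fits (Suc i) N (r - m))"
    proof -
      have "{x \<in> {i+1..N}. x \<le> Suc i} = {Suc i}" "{x \<in> {i+1..N}. \<not> x \<le> Suc i} = {Suc i + 1..N}"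
        by (auto simp: N_def)
      then show ?thesis by (simp add: num_fits_def words_def card_lists_length_eq)
    qed
    finally have "D * real (num_fits i N r) =
      (\<Sum>m\<le>r. real (r choose m) * (real (num_fits (Suc i) N (r - m)) * D))"
      by (simp add: sum_distrib_left algebra_simps)
    \<comment> \<open>Rewriting \<open>D - (r - m)\<close> as \<open>m - (r - D)\<close> gives the
      shape of \<open>sum_binomial_linear\<close> with \<open>x = D\<close> and
      \<open>s = 1\<close>.\<close>
    also have "\<dots> = (\<Sum>m\<le>r. real (r choose m) * (real m - (real r - D)) * 1 ^ m * D ^ (r - m))"
    proof (intro sum.cong refl)
      fix m assume "m \<in> {..r}"
      then show "real (r choose m) * (real (num_fits (Suc i) N (r - m)) * D) =
        real (r choose m) * (real m - (real r - D)) * 1 ^ m * D ^ (r - m)"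
        using Suc.IH[of "r - m" "Suc i"] True by (simp add: N_def D_def of_nat_diff)
    qed
    finally have "D * (real (num_fits i N r) * (D + 1)) = (real r - (real r - D) * (D + 1)) * (D + 1) ^ r"
      using sum_binomial_linear[of D 1 r "real r - D"] by (simp add: algebra_simps)
    also have "\<dots> = D * ((D + 1 - real r) * (D + 1) ^ r)" by (simp add: algebra_simps)
    finally have "real (num_fits i N r) * (D + 1) = (D + 1 - real r) * (D + 1) ^ r" using D by simp
    then show ?thesis by (simp add: D_def N_def add.commute add.left_commute)
  qed
qed

section \<open>Words over i+1..j that are lucky at j\<close>

definition num_lucky_words :: "nat \<Rightarrow> nat \<Rightarrow> nat \<Rightarrow> nat" where
  "num_lucky_words i j m = card {w \<in> words {i+1..j} m. lucky_word j w}"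

definition num_lucky_filling_words :: "nat \<Rightarrow> nat \<Rightarrow> nat" where
  "num_lucky_filling_words j m = card {w \<in> words {1..j} m. fills j w \<and> lucky_word j w}"

lemma lucky_word_snoc:
  "lucky_word j (w @ [y]) \<longleftrightarrow>
    lucky_word j w \<or> (y = j \<and> j \<notin> set w \<and> fits (j - 1) {} (filter (\<lambda>x. x < j) w))"
proof (cases "j \<in> set w")
  case True
  then show ?thesis by (auto simp: lucky_word_def takeWhile_append)
next
  case False
  then have "takeWhile (\<lambda>x. x \<noteq> j) (w @ v) = w @ takeWhile (\<lambda>x. x \<noteq> j) v" for v
    by (intro takeWhile_append2) auto
  then show ?thesis using False by (auto simp: lucky_word_def)
qed

text \<open>Count by the last letter: any of the \<open>j - i\<close> letters keeps a lucky word
  lucky, and the letter \<open>j\<close> also makes lucky those \<open>j\<close>-free words that fit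
  below \<open>j\<close>.\<close>

lemma num_lucky_words_Suc:
  assumes "i < j"
  shows "num_lucky_words i j (Suc m) = (j - i) * num_lucky_words i j m + num_fits i (j - 1) m"
proof -
  let ?S = "{i+1..j}"
  let ?L = "{w \<in> words ?S m. lucky_word j w}"
  let ?F = "{w \<in> words {i+1..j-1} m. fits (j - 1) {} w}"
  have last: "{w \<in> words ?S m. lucky_word j (w @ [j])} = ?L \<union> ?F"
  proof -
    have "w \<in> words ?S m \<and> j \<notin> set w \<and> fits (j - 1) {} (filter (\<lambda>x. x < j) w) \<longleftrightarrow> w \<in> ?F" for w
    proof -
      have "w \<in> words ?S m \<and> j \<notin> set w \<longleftrightarrow> w \<in> words {i+1..j-1} m"
      proof -
        have "{i+1..j-1} = ?S - {j}" using assms by auto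
        then show ?thesis by (auto simp: words_def)
      qed
      moreover have "filter (\<lambda>x. x < j) w = w" if "w \<in> words {i+1..j-1} m"
        using that assms by (force simp: words_def filter_id_conv)
      ultimately show ?thesis by auto
    qed
    then show ?thesis by (auto simp: lucky_word_snoc)
  qed
  have disj: "?L \<inter> ?F = {}"
    using assms by (force simp: lucky_word_def words_def)
  have "num_lucky_words i j (Suc m) = (\<Sum>y\<in>?S. card {w \<in> words ?S m. lucky_word j (w @ [y])})"
    unfolding num_lucky_words_def by (rule card_words_snoc) simp
  also have "\<dots> = (\<Sum>y\<in>?S. card ?L + (if y = j then card ?F else 0))"
  proof (intro sum.cong refl)
    fix y assume "y \<in> ?S"
    show "card {w \<in> words ?S m. lucky_word j (w @ [y])} = card ?L + (if y = j then card ?F else 0)"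
    proof (cases "y = j")
      case True
      then show ?thesis using last disj by (simp add: card_Un_disjoint)
    qed (simp add: lucky_word_snoc)
  qed
  also have "\<dots> = (j - i) * card ?L + card ?F"
    using assms by (simp add: sum.distrib)
  finally show ?thesis by (simp add: num_lucky_words_def num_fits_def)
qed

text \<open>With \<open>J = j - i\<close>, a random word has its first \<open>j\<close> at position
  \<open>m + 1\<close> and lucky with probability \<open>(J - m) / J^2\<close>, by
  \<open>num_fits_formula\<close>. Summing over \<open>m < J\<close> gives
  \<open>(J + 1) / (2 J)\<close>.\<close>

lemma num_lucky_words_formula:
  assumes "i < j" "j - i \<le> m"
  shows "real (num_lucky_words i j m) = (real (j - i) + 1) / (2 * real (j - i)) * real (j - i) ^ m"
proof -
  define J where "J = j - i"
  have J: "J > 0" "j - 1 = i + (J - 1)" "real (J - 1) = real J - 1"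
    using assms by (auto simp: J_def)
  let ?F = "\<lambda>m. real (num_fits i (j - 1) m)"
  have early: "real (num_lucky_words i j m) * (2 * real J ^ 2) =
      real J ^ m * (2 * real m * real J - real m * (real m - 1))" if "m \<le> J" for m
    using that
  proof (induction m)
    case 0
    have "{w \<in> words {i+1..j} 0. lucky_word j w} = {}" by (auto simp: words_def lucky_word_def)
    then show ?case by (simp add: num_lucky_words_def)
  next
    case (Suc m)
    have F: "?F m * real J = (real J - real m) * real J ^ m"
      using num_fits_formula[of m "J - 1" i] Suc.prems J by simp
    have "real (num_lucky_words i j (Suc m)) * (2 * real J ^ 2) =
        real J * (real (num_lucky_words i j m) * (2 * real J ^ 2)) + 2 * real J * (?F m * real J)"
      by (simp add: num_lucky_words_Suc[OF assms(1)] J_def[symmetric] algebra_simps power2_eq_square)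
    also have "\<dots> = real J ^ Suc m * (2 * real (Suc m) * real J - real (Suc m) * (real (Suc m) - 1))"
    proof -
      have IH: "real (num_lucky_words i j m) * (2 * real J ^ 2) =
          real J ^ m * (2 * real m * real J - real m * (real m - 1))"
        using Suc by simp
      show ?thesis unfolding F IH by (simp add: algebra_simps)
    qed
    finally show ?case .
  qed
  \<comment> \<open>At \<open>m = J\<close> the formula \<open>early\<close> gives the claim; beyond
    that no \<open>j\<close>-free word fits, so each further letter just multiplies by
    \<open>J\<close>.\<close>
  have "real (num_lucky_words i j m) * (2 * real J) = (real J + 1) * real J ^ m"
    using assms(2)[folded J_def]
  proof (induction m rule: dec_induct)
    case base
    have "real J * (real (num_lucky_words i j J) * (2 * real J)) = real J * ((real J + 1) * real J ^ J)"
      using early[of J] by (simp add: algebra_simps power2_eq_square)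
    then show ?case using J by simp
  next
    case (step m)
    have "num_fits i (j - 1) m = 0" using step J by (intro num_fits_eq_0) auto
    then show ?case
      using step by (simp add: num_lucky_words_Suc[OF assms(1)] J_def[symmetric] algebra_simps)
  qed
  then show ?thesis using J by (simp add: J_def[symmetric] field_simps)
qed

section \<open>Decompositions by the smallest empty spot and by preferences at most j\<close>

lemma takeWhile_filter_neq:
  "P j \<Longrightarrow> takeWhile (\<lambda>x. x \<noteq> j) (filter P w) = filter P (takeWhile (\<lambda>x. x \<noteq> j) w)"
  by (induction w) auto

lemma lucky_word_filter_le: "lucky_word j (filter (\<lambda>x. x \<le> j) w) \<longleftrightarrow> lucky_word j w"
proof -
  have "filter (\<lambda>x. x < j) (filter (\<lambda>x. x \<le> j) u) = filter (\<lambda>x. x < j) u" for u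
    by (induction u) auto
  then show ?thesis by (simp add: lucky_word_def takeWhile_filter_neq)
qed

text \<open>
  If spot \<open>k + 1\<close> stays empty, the cars preferring \<open>1..k\<close> never get past it.
\<close>

lemma lucky_word_filter_gt:
  assumes "fits k {} (filter (\<lambda>x. x \<le> k) w)" "Suc k \<notin> set w" "k < j"
  shows "lucky_word j (filter (\<lambda>x. \<not> x \<le> k) w) \<longleftrightarrow> lucky_word j w"
proof (cases "j \<in> set w")
  case True
  then have j: "Suc k < j" using assms by (metis Suc_lessI)
  let ?t = "takeWhile (\<lambda>x. x \<noteq> j) w"
  define L where "L = (\<lambda>s. length (filter (\<lambda>x. s < x \<and> x < j) ?t))"
  define G where "G = (\<lambda>s. length (filter (\<lambda>x. s < x \<and> k < x \<and> x < j) ?t))"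
  have low: "length (filter (\<lambda>x. s < x \<and> x \<le> k) ?t) \<le> k - s" if "s < k" for s
  proof -
    have "length (filter (\<lambda>x. s < x \<and> x \<le> k) ?t) \<le> length (filter (\<lambda>x. s < x \<and> x \<le> k) w)"
      by (induction w) auto
    also have "\<dots> = length (filter (\<lambda>x. s < x) (filter (\<lambda>x. x \<le> k) w))"
      by (simp add: filter_filter conj_commute)
    also have "\<dots> \<le> k - s" using assms(1) that unfolding fits_def by fastforce
    finally show ?thesis .
  qed
  have split: "L s = length (filter (\<lambda>x. s < x \<and> x \<le> k) ?t) + G k" if "s < k" for s
  proof -
    have "length (filter (\<lambda>x. s < x \<and> x < j) u) =
        length (filter (\<lambda>x. s < x \<and> x \<le> k) u) + length (filter (\<lambda>x. k < x \<and> k < x \<and> x < j) u)" for u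
      using that assms(3) by (induction u) auto
    then show ?thesis by (simp add: L_def G_def)
  qed
  \<comment> \<open>The missing letter \<open>Suc k\<close> improves the bound on \<open>G k\<close>
    from \<open>j - 1 - k\<close> to \<open>j - 2 - k\<close>. Together with at most
    \<open>k - s\<close> letters in \<open>s+1..k\<close>, this stays below the capacity
    \<open>j - 1 - s\<close>.\<close>
  have "Suc k \<notin> set ?t" using assms(2) by (meson set_takeWhileD)
  then have gap: "G k = G (Suc k)"
    unfolding G_def by (intro arg_cong[of _ _ length] filter_cong refl) (metis Suc_lessI Suc_lessD)
  have high: "L s = G s" if "k \<le> s" for s
    unfolding L_def G_def using that by (intro arg_cong[of _ _ length] filter_cong) auto
  have G_le: "G s \<le> L s" for s unfolding L_def G_def by (rule length_filter_mono) auto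
  have "(\<forall>s\<le>j-1. G s \<le> j - 1 - s) \<longleftrightarrow> (\<forall>s\<le>j-1. L s \<le> j - 1 - s)"
  proof (intro iffI allI impI)
    fix s assume h: "\<forall>s\<le>j-1. G s \<le> j - 1 - s" and s: "s \<le> j - 1"
    show "L s \<le> j - 1 - s"
    proof (cases "s < k")
      case True
      have "G (Suc k) \<le> j - 1 - Suc k" using h j by simp
      then show ?thesis using split[OF True] low[OF True] gap True j by simp
    qed (use h s high in simp)
  qed (use G_le le_trans in blast)
  then have "fits (j - 1) {} (filter (\<lambda>x. x < j) (filter (\<lambda>x. \<not> x \<le> k) ?t)) \<longleftrightarrow>
      fits (j - 1) {} (filter (\<lambda>x. x < j) ?t)"
    by (simp add: fits_def L_def G_def filter_filter conj_ac not_le)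
  then show ?thesis using True assms(3) by (simp add: lucky_word_def takeWhile_filter_neq)
qed (simp add: lucky_word_def)

lemma length_filter_le_gt:
  fixes s :: nat
  shows "length (filter (\<lambda>x. x \<le> s) w) + length (filter (\<lambda>x. s < x) w) = length w"
  using sum_length_filter_compl[of "\<lambda>x. x \<le> s" w] by (simp add: not_le)

text \<open>Here \<open>Suc k\<close> is the smallest empty spot: \<open>fills k\<close> forces at
  least \<open>k\<close> letters up to \<open>k\<close>, so there are exactly \<open>k\<close> of
  them and no letter \<open>Suc k\<close>. They form a parking function of \<open>1..k\<close>, and
  luckiness passes to the rest by \<open>lucky_word_filter_gt\<close>.\<close>

lemma num_lucky_words_unfilled:
  assumes "k < j"
  shows "card {w \<in> words {1..j} m. lucky_word j w \<and> fills k w \<and> \<not> Suc k \<le> length (filter (\<lambda>x. x \<le> Suc k) w)} =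
    (m choose k) * (num_fits 0 k k * num_lucky_words (Suc k) j (m - k))"
proof -
  let ?S = "{1..j} - {Suc k}"
  have sets: "{x \<in> ?S. x \<le> k} = {0+1..k}" "{x \<in> ?S. \<not> x \<le> k} = {Suc k + 1..j}"
    using assms by auto
  have "{w \<in> words {1..j} m. lucky_word j w \<and> fills k w \<and> \<not> Suc k \<le> length (filter (\<lambda>x. x \<le> Suc k) w)} =
    {w \<in> words ?S m. (length (filter (\<lambda>x. x \<le> k) w) = k \<and> fits k {} (filter (\<lambda>x. x \<le> k) w)) \<and>
      lucky_word j (filter (\<lambda>x. \<not> x \<le> k) w)}" (is "?L = ?R")
  proof -
    have mem: "w \<in> words {1..j} m \<and> fills k w \<and> \<not> Suc k \<le> length (filter (\<lambda>x. x \<le> Suc k) w) \<longleftrightarrow>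
      w \<in> words ?S m \<and> length (filter (\<lambda>x. x \<le> k) w) = k \<and> fits k {} (filter (\<lambda>x. x \<le> k) w)" for w
    proof -
      let ?u = "filter (\<lambda>x. x \<le> k) w"
      have mid: "length (filter (\<lambda>x. x \<le> Suc k) w) = length ?u + count_list w (Suc k)"
        by (induction w) auto
      have "s \<le> k \<Longrightarrow> filter (\<lambda>x. x \<le> s) ?u = filter (\<lambda>x. x \<le> s) w" for s
        unfolding filter_filter by (intro filter_cong) auto
      then have compl: "s \<le> k \<Longrightarrow> length (filter (\<lambda>x. x \<le> s) w) + length (filter (\<lambda>x. s < x) ?u) = length ?u" for s
        using length_filter_le_gt[of s ?u] by simp
      \<comment> \<open>With exactly \<open>k\<close> small letters, upper bounds on the letters
        above \<open>s\<close> are lower bounds on those up to \<open>s\<close>.\<close>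
      have fits: "fits k {} ?u \<longleftrightarrow> fills k w" if "length ?u = k"
      proof -
        have "length (filter (\<lambda>x. s < x) ?u) \<le> k - s \<longleftrightarrow> s \<le> length (filter (\<lambda>x. x \<le> s) w)" if "s \<le> k" for s
          using compl[OF that] \<open>length ?u = k\<close> that by linarith
        then show ?thesis by (simp add: fits_def fills_def)
      qed
      have "fills k w \<Longrightarrow> k \<le> length ?u" by (simp add: fills_def)
      then have "fills k w \<and> \<not> Suc k \<le> length (filter (\<lambda>x. x \<le> Suc k) w) \<longleftrightarrow>
        Suc k \<notin> set w \<and> length ?u = k \<and> fits k {} ?u"
        using fits mid by (auto simp: count_list_0_iff[symmetric])
      then show ?thesis by (auto simp: words_def)
    qed
    show ?thesis
    proof (intro Collect_cong)
      fix w
      have "lucky_word j (filter (\<lambda>x. \<not> x \<le> k) w) \<longleftrightarrow> lucky_word j w"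
        if "w \<in> words ?S m" "fits k {} (filter (\<lambda>x. x \<le> k) w)"
        using that assms by (intro lucky_word_filter_gt) (auto simp: words_def)
      then show "(w \<in> words {1..j} m \<and> lucky_word j w \<and> fills k w \<and> \<not> Suc k \<le> length (filter (\<lambda>x. x \<le> Suc k) w)) =
        (w \<in> words ?S m \<and> (length (filter (\<lambda>x. x \<le> k) w) = k \<and> fits k {} (filter (\<lambda>x. x \<le> k) w)) \<and>
          lucky_word j (filter (\<lambda>x. \<not> x \<le> k) w))"
        using mem[of w] by blast
    qed
  qed
  then have "card ?L = card ?R" by simp
  also have "\<dots> = (\<Sum>i\<le>m. (m choose i) * (card {u \<in> words {x \<in> ?S. x \<le> k} i. length u = k \<and> fits k {} u} *
      card {v \<in> words {x \<in> ?S. \<not> x \<le> k} (m - i). lucky_word j v}))"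
    by (rule card_words_filter_split) simp
  also have "\<dots> = (\<Sum>i\<le>m. if i = k then (m choose k) * (num_fits 0 k k * num_lucky_words (Suc k) j (m - k)) else 0)"
  proof (intro sum.cong refl)
    fix i
    have "{u \<in> words {0+1..k} i. length u = k \<and> fits k {} u} =
      (if i = k then {u \<in> words {0+1..k} k. fits k {} u} else {})" by (auto simp: words_def)
    then show "(m choose i) * (card {u \<in> words {x \<in> ?S. x \<le> k} i. length u = k \<and> fits k {} u} *
        card {v \<in> words {x \<in> ?S. \<not> x \<le> k} (m - i). lucky_word j v}) =
      (if i = k then (m choose k) * (num_fits 0 k k * num_lucky_words (Suc k) j (m - k)) else 0)"
      unfolding sets num_fits_def num_lucky_words_def by simp
  qed
  also have "\<dots> = (m choose k) * (num_fits 0 k k * num_lucky_words (Suc k) j (m - k))"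
    by (cases "k \<le> m") (simp_all add: binomial_eq_0)
  finally show ?thesis .
qed

text \<open>A word not filling \<open>1..j\<close> fails first at a unique \<open>Suc k\<close>,
  since \<open>fills\<close> passes down to smaller bounds.\<close>

lemma num_lucky_words_eq:
  "num_lucky_words 0 j m = num_lucky_filling_words j m +
    (\<Sum>k<j. (m choose k) * (num_fits 0 k k * num_lucky_words (Suc k) j (m - k)))"
proof -
  let ?fill = "\<lambda>s w. s \<le> length (filter (\<lambda>x. x \<le> s) w)"
  let ?B = "\<lambda>k. {w \<in> words {1..j} m. lucky_word j w \<and> fills k w \<and> \<not> ?fill (Suc k) w}"
  let ?W = "{w \<in> words {1..j} m. fills j w \<and> lucky_word j w}"
  have fills_Suc: "fills (Suc k) w \<longleftrightarrow> fills k w \<and> ?fill (Suc k) w" for k w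
    by (auto simp: fills_def le_Suc_eq)
  have fills_mono: "fills l w \<Longrightarrow> k \<le> l \<Longrightarrow> fills k w" for k l w
    by (auto simp: fills_def)
  have "\<not> fills j w \<longleftrightarrow> (\<exists>k<j. fills k w \<and> \<not> ?fill (Suc k) w)" for w
  proof (induction j)
    case 0
    show ?case by (simp add: fills_def)
  next
    case (Suc j)
    then show ?case by (auto simp: fills_Suc less_Suc_eq)
  qed
  then have "{w \<in> words {1..j} m. lucky_word j w} = ?W \<union> (\<Union>k<j. ?B k)" by blast
  then have "num_lucky_words 0 j m = card (?W \<union> (\<Union>k<j. ?B k))" by (simp add: num_lucky_words_def)
  also have "\<dots> = card ?W + card (\<Union>k<j. ?B k)"
  proof (rule card_Un_disjoint)
    have "\<not> fills j w" if "k < j" "\<not> ?fill (Suc k) w" for k w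
      using that fills_mono[of j w "Suc k"] fills_Suc by auto
    then show "?W \<inter> (\<Union>k<j. ?B k) = {}" by blast
  qed auto
  also have "card (\<Union>k<j. ?B k) = (\<Sum>k<j. card (?B k))"
  proof (rule card_UN_disjoint)
    have "k = l" if "fills k w" "\<not> ?fill (Suc k) w" "fills l w" "\<not> ?fill (Suc l) w" for k l w
      using that fills_mono[of k w "Suc l"] fills_mono[of l w "Suc k"] fills_Suc
      by (metis Suc_leI linorder_neqE_nat)
    then show "\<forall>k\<in>{..<j}. \<forall>l\<in>{..<j}. k \<noteq> l \<longrightarrow> ?B k \<inter> ?B l = {}" by blast
  qed auto
  also have "\<dots> = (\<Sum>k<j. (m choose k) * (num_fits 0 k k * num_lucky_words (Suc k) j (m - k)))"
    by (intro sum.cong refl num_lucky_words_unfilled) simp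
  finally show ?thesis by (simp add: num_lucky_filling_words_def)
qed

text \<open>In a word of length \<open>n\<close>, the capacity conditions at
  \<open>s \<le> j\<close> become \<open>fills j\<close> by complement, and those at larger
  \<open>s\<close> see only letters above \<open>j\<close>. Luckiness sees only letters up to
  \<open>j\<close>, so the two subwords are counted independently.\<close>

lemma num_lucky_spot_eq_sum:
  assumes "1 \<le> j" "j \<le> n"
  shows "num_lucky_spot n j = (\<Sum>m\<le>n. (n choose m) * (num_lucky_filling_words j m * num_fits j n (n - m)))"
proof -
  have sets: "{x \<in> {1..n}. x \<le> j} = {1..j}" "{x \<in> {1..n}. \<not> x \<le> j} = {j+1..n}" using assms by auto
  have fits: "fits n {} a \<longleftrightarrow> fills j (filter (\<lambda>x. x \<le> j) a) \<and> fits n {} (filter (\<lambda>x. \<not> x \<le> j) a)"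
    if "length a = n" for a
  proof -
    have lo: "filter (\<lambda>x. x \<le> s) (filter (\<lambda>x. x \<le> j) a) = filter (\<lambda>x. x \<le> s) a" if "s \<le> j" for s
      unfolding filter_filter using that by (intro filter_cong) auto
    have hi: "filter (\<lambda>x. s < x) (filter (\<lambda>x. \<not> x \<le> j) a) = filter (\<lambda>x. s < x) a" if "j \<le> s" for s
      unfolding filter_filter using that by (intro filter_cong) auto
    have hi': "length (filter (\<lambda>x. s < x) (filter (\<lambda>x. \<not> x \<le> j) a)) \<le> length (filter (\<lambda>x. s < x) a)" for s
      unfolding filter_filter by (rule length_filter_mono) auto
    have compl: "length (filter (\<lambda>x. s < x) a) \<le> n - s \<longleftrightarrow> s \<le> length (filter (\<lambda>x. x \<le> s) a)" if "s \<le> n" for s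
      using length_filter_le_gt[of s a] \<open>length a = n\<close> that by linarith
    show ?thesis
    proof
      assume h: "fits n {} a"
      then have le: "length (filter (\<lambda>x. s < x) a) \<le> n - s" if "s \<le> n" for s
        using that by (simp add: fits_def)
      have "fills j (filter (\<lambda>x. x \<le> j) a)"
        unfolding fills_def using lo compl le assms by auto
      moreover have "fits n {} (filter (\<lambda>x. \<not> x \<le> j) a)"
        unfolding fits_def using le hi' by (auto intro: le_trans)
      ultimately show "fills j (filter (\<lambda>x. x \<le> j) a) \<and> fits n {} (filter (\<lambda>x. \<not> x \<le> j) a)" ..
    next
      assume h: "fills j (filter (\<lambda>x. x \<le> j) a) \<and> fits n {} (filter (\<lambda>x. \<not> x \<le> j) a)"
      have "length (filter (\<lambda>x. s < x) a) \<le> n - s" if "s \<le> n" for s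
      proof (cases "s \<le> j")
        case True
        then show ?thesis using h lo[OF True] compl[OF that] unfolding fills_def by metis
      next
        case False
        then have "filter (\<lambda>x. s < x) a = filter (\<lambda>x. s < x) (filter (\<lambda>x. \<not> x \<le> j) a)"
          by (intro hi[symmetric]) simp
        moreover have "length (filter (\<lambda>x. s < x) (filter (\<lambda>x. \<not> x \<le> j) a)) \<le> card ({s+1..n} - {})"
          using h that unfolding fits_def by blast
        ultimately show ?thesis by (simp del: filter_filter)
      qed
      then show "fits n {} a" by (simp add: fits_def)
    qed
  qed
  have "{a. parking_function n a \<and> lucky_spot n a j} =
    {a \<in> words {1..n} n. (fills j (filter (\<lambda>x. x \<le> j) a) \<and> lucky_word j (filter (\<lambda>x. x \<le> j) a)) \<and>
      fits n {} (filter (\<lambda>x. \<not> x \<le> j) a)}"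
    using fits assms
    by (auto simp: parking_function_iff_fits words_def lucky_spot_iff_lucky_word lucky_word_filter_le)
  then have "num_lucky_spot n j = card \<dots>" by (simp add: num_lucky_spot_def)
  also have "\<dots> = (\<Sum>m\<le>n. (n choose m) *
     (card {u \<in> words {x \<in> {1..n}. x \<le> j} m. fills j u \<and> lucky_word j u} *
      card {v \<in> words {x \<in> {1..n}. \<not> x \<le> j} (n - m). fits n {} v}))"
    by (rule card_words_filter_split) simp
  finally show ?thesis unfolding sets num_lucky_filling_words_def num_fits_def .
qed

section \<open>The number of parking functions with spot j lucky\<close>

text \<open>
  The extension to all \<open>m\<close> of the closed form for \<open>num_lucky_filling_words j m\<close>, with which it
  agrees only for \<open>m \<ge> j\<close>.
\<close>

definition filling_ext :: "nat \<Rightarrow> nat \<Rightarrow> real" where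
  "filling_ext j m = (real j + 1) / (2 * real j) * real j ^ m -
    (\<Sum>k<j-1. (real k + 1) ^ k / (real k + 1) * ((real (j - 1 - k) + 1) / (2 * real (j - 1 - k))) *
      (real (m choose k) * real (j - 1 - k) ^ (m - k)))"

lemma num_lucky_filling_words_formula:
  assumes "1 \<le> j" "j \<le> m"
  shows "real (num_lucky_filling_words j m) = filling_ext j m"
proof -
  let ?f = "\<lambda>k. (m choose k) * (num_fits 0 k k * num_lucky_words (Suc k) j (m - k))"
  \<comment> \<open>A lucky word contains \<open>j\<close>, so spot \<open>j\<close> is never the
    empty one and the term \<open>k = j - 1\<close> drops out.\<close>
  have "num_lucky_words j j r = 0" for r
    by (auto simp: num_lucky_words_def words_def lucky_word_def)
  then have "(\<Sum>k<j. ?f k) = (\<Sum>k<j-1. ?f k)"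
    using assms(1) by (cases j) auto
  then have "real (num_lucky_words 0 j m) = real (num_lucky_filling_words j m) + (\<Sum>k<j-1. real (?f k))"
    using num_lucky_words_eq[of j m] by simp
  moreover have "real (num_lucky_words 0 j m) = (real j + 1) / (2 * real j) * real j ^ m"
    using num_lucky_words_formula[of 0 j m] assms by simp
  moreover have "(\<Sum>k<j-1. real (?f k)) =
    (\<Sum>k<j-1. (real k + 1) ^ k / (real k + 1) * ((real (j - 1 - k) + 1) / (2 * real (j - 1 - k))) *
      (real (m choose k) * real (j - 1 - k) ^ (m - k)))"
  proof (intro sum.cong refl)
    fix k assume "k \<in> {..<j-1}"
    then have k: "Suc k < j" by auto
    \<comment> \<open>The classical count \<open>(k + 1)^(k - 1)\<close> of parking functions, kept
      as a quotient so that \<open>k = 0\<close> is included.\<close>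
    have "real (num_fits 0 k k) * (real k + 1) = (real k + 1) ^ k"
      using num_fits_formula[of k k 0] by simp
    then have 1: "real (num_fits 0 k k) = (real k + 1) ^ k / (real k + 1)"
      by (simp add: field_simps)
    have 2: "real (num_lucky_words (Suc k) j (m - k)) =
        (real (j - 1 - k) + 1) / (2 * real (j - 1 - k)) * real (j - 1 - k) ^ (m - k)"
      using num_lucky_words_formula[of "Suc k" j "m - k"] k assms by simp
    show "real (?f k) = (real k + 1) ^ k / (real k + 1) *
        ((real (j - 1 - k) + 1) / (2 * real (j - 1 - k))) *
        (real (m choose k) * real (j - 1 - k) ^ (m - k))"
      unfolding of_nat_mult 1 2 by (simp only: mult_ac)
  qed
  ultimately show ?thesis by (simp add: filling_ext_def)
qed

text \<open>Shifting \<open>m = i + k\<close> and using \<open>choose_mult\<close> leaves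
  \<open>sum_binomial_linear\<close> for \<open>n - k\<close> with \<open>c = s\<close>. Its linear
  factor \<open>(n - k) s - s (x + s)\<close> vanishes, and \<open>k < n\<close> allows cancelling
  \<open>x + s\<close>.\<close>

lemma binomial_kernel:
  fixes x :: real
  assumes "k < n" "x + s = real (n - k)"
  shows "(\<Sum>m\<le>n. real (n choose m) * (real m - (s + real k)) * x ^ (n - m) * (real (m choose k) * s ^ (m - k))) = 0"
proof -
  let ?f = "\<lambda>m. real (n choose m) * (real m - (s + real k)) * x ^ (n - m) * (real (m choose k) * s ^ (m - k))"
  have "(\<Sum>m\<le>n. ?f m) = (\<Sum>m=k..n. ?f m)"
    by (rule sum.mono_neutral_right) (auto simp: binomial_eq_0)
  also have "\<dots> = (\<Sum>i\<le>n - k. ?f (i + k))"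
    using assms(1) sum.shift_bounds_cl_nat_ivl[of ?f 0 k "n - k"] by (simp add: atLeast0AtMost)
  also have "\<dots> = real (n choose k) * (\<Sum>i\<le>n - k. real (n - k choose i) * (real i - s) * s ^ i * x ^ (n - k - i))"
    unfolding sum_distrib_left
  proof (intro sum.cong refl)
    fix i assume "i \<in> {..n - k}"
    then have "(n choose (i + k)) * (i + k choose k) = (n choose k) * (n - k choose i)"
      using choose_mult[of k "i + k" n] assms(1) by simp
    then have "real (n choose (i + k)) * real (i + k choose k) = real (n choose k) * real (n - k choose i)"
      by (metis of_nat_mult)
    moreover have "n - (i + k) = n - k - i" by simp
    moreover have "?f (i + k) = real (n choose (i + k)) * real (i + k choose k) * ((real i - s) * s ^ i * x ^ (n - (i + k)))"
      by simp
    ultimately show "?f (i + k) = real (n choose k) * (real (n - k choose i) * (real i - s) * s ^ i * x ^ (n - k - i))"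
      by (simp only: mult.assoc)
  qed
  also have "(\<Sum>i\<le>n - k. real (n - k choose i) * (real i - s) * s ^ i * x ^ (n - k - i)) = 0"
    using sum_binomial_linear[of x s "n - k" s] assms by simp
  finally show ?thesis by simp
qed

text \<open>Each correction in \<open>filling_ext\<close> is annihilated by
  \<open>binomial_kernel\<close> with \<open>x = n - j + 1\<close> and \<open>s = j - 1 - k\<close>;
  only the pure power of \<open>j\<close> contributes.\<close>

lemma sum_filling_ext:
  assumes "1 \<le> j" "j \<le> n"
  shows "(\<Sum>m\<le>n. real (n choose m) * (real m - (real j - 1)) * (real (n - j) + 1) ^ (n - m) * filling_ext j m) =
    (real (n - j) + 1) * ((real j + 1) / (2 * real j) * (real n + 1) ^ (n - 1))"
proof -
  define N where "N = real (n - j) + 1"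
  let ?h = "\<lambda>m. real (n choose m) * (real m - (real j - 1)) * N ^ (n - m)"
  define a where "a = (real j + 1) / (2 * real j)"
  define b where "b = (\<lambda>k. (real k + 1) ^ k / (real k + 1) * ((real (j - 1 - k) + 1) / (2 * real (j - 1 - k))))"
  have "(\<Sum>m\<le>n. ?h m * filling_ext j m) = a * (\<Sum>m\<le>n. ?h m * real j ^ m) -
      (\<Sum>m\<le>n. \<Sum>k<j-1. b k * (?h m * (real (m choose k) * real (j - 1 - k) ^ (m - k))))"
  proof -
    have "h * (a * p - (\<Sum>k<j-1. b k * X k)) = a * (h * p) - (\<Sum>k<j-1. b k * (h * X k))" for h p X
      by (simp add: right_diff_distrib sum_distrib_left mult_ac)
    then show ?thesis
      unfolding sum_distrib_left sum_subtractf[symmetric]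
      by (simp only: filling_ext_def a_def b_def)
  qed
  also have "(\<Sum>m\<le>n. \<Sum>k<j-1. b k * (?h m * (real (m choose k) * real (j - 1 - k) ^ (m - k)))) =
      (\<Sum>k<j-1. b k * (\<Sum>m\<le>n. ?h m * (real (m choose k) * real (j - 1 - k) ^ (m - k))))"
    by (subst sum.swap) (simp add: sum_distrib_left)
  also have "\<dots> = 0"
  proof (intro sum.neutral ballI)
    fix k assume "k \<in> {..<j-1}"
    then have k: "k < j - 1" by simp
    have "real j - 1 = real (j - 1 - k) + real k" using k by (simp add: of_nat_diff)
    moreover have "N + real (j - 1 - k) = real (n - k)" using k assms by (simp add: N_def of_nat_diff)
    ultimately have "(\<Sum>m\<le>n. ?h m * (real (m choose k) * real (j - 1 - k) ^ (m - k))) = 0"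
      using binomial_kernel[of k n N "real (j - 1 - k)"] k assms by simp
    then show "b k * (\<Sum>m\<le>n. ?h m * (real (m choose k) * real (j - 1 - k) ^ (m - k))) = 0" by simp
  qed
  also have "(\<Sum>m\<le>n. ?h m * real j ^ m) = N * (real n + 1) ^ (n - 1)"
  proof -
    have Nj: "N + real j = real n + 1" using assms by (simp add: N_def of_nat_diff)
    have "(real n + 1) * (\<Sum>m\<le>n. ?h m * real j ^ m) =
        (real n * real j - (real j - 1) * (real n + 1)) * (real n + 1) ^ n"
      using sum_binomial_linear[of N "real j" n "real j - 1"] by (simp add: Nj mult_ac)
    \<comment> \<open>The linear factor collapses to \<open>n + 1 - j\<close>, which is
      \<open>N\<close>.\<close>
    also have "real n * real j - (real j - 1) * (real n + 1) = N"
      using Nj by (simp add: algebra_simps)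
    also have "(real n + 1) ^ n = (real n + 1) * (real n + 1) ^ (n - 1)"
      using assms by (cases n) auto
    finally have eq: "(real n + 1) * (\<Sum>m\<le>n. ?h m * real j ^ m) = (real n + 1) * (N * (real n + 1) ^ (n - 1))"
      by (simp only: mult_ac)
    have "real n + 1 \<noteq> 0" by linarith
    from this eq show ?thesis by (rule mult_left_cancel[THEN iffD1])
  qed
  finally show ?thesis by (simp add: N_def a_def mult_ac)
qed

text \<open>The true summand agrees with the extended one for \<open>m \<ge> j - 1\<close> and is
  zero below. So the count is the full extended sum minus its part with \<open>m < j - 1\<close>;
  there the weight \<open>m - (j - 1)\<close> is negative, which turns the subtraction into a sum.
  One factor \<open>N\<close> is cancelled at the end.\<close>

theorem num_lucky_spot_formula:
  assumes "1 \<le> j" "j \<le> n"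
  shows "real (num_lucky_spot n j) = (real j + 1) / (2 * real j) * (real n + 1) ^ (n - 1) +
    (\<Sum>m<j-1. real (n choose m) * real (j - 1 - m) * (real (n - j) + 1) ^ (n - m - 1) * filling_ext j m)"
proof -
  define N where "N = real (n - j) + 1"
  have N: "N > 0" by (simp add: N_def)
  let ?g = "\<lambda>m. real (n choose m) * (real m - (real j - 1)) * N ^ (n - m) * filling_ext j m"
  have "N * real (num_lucky_spot n j) =
      (\<Sum>m\<le>n. real (n choose m) * real (num_lucky_filling_words j m) * (real (num_fits j n (n - m)) * N))"
    using assms by (simp add: num_lucky_spot_eq_sum sum_distrib_left mult_ac)
  also have "\<dots> = (\<Sum>m\<le>n. if m < j - 1 then 0 else ?g m)"
  proof (intro sum.cong refl)
    fix m assume "m \<in> {..n}"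
    then have m: "m \<le> n" by simp
    show "real (n choose m) * real (num_lucky_filling_words j m) * (real (num_fits j n (n - m)) * N) =
        (if m < j - 1 then 0 else ?g m)"
    proof (cases "j \<le> m")
      case True
      have "real (num_fits j n (n - m)) * N = (N - real (n - m)) * N ^ (n - m)"
        using num_fits_formula[of "n - m" "n - j" j] assms True by (simp add: N_def)
      moreover have "N - real (n - m) = real m - (real j - 1)"
        using m assms by (simp add: N_def of_nat_diff)
      moreover have "\<not> m < j - 1" using True by simp
      ultimately show ?thesis using True assms
        by (simp add: num_lucky_filling_words_formula)
    next
      case False
      then have "num_fits j n (n - m) = 0" using assms m by (intro num_fits_eq_0) auto
      \<comment> \<open>At \<open>m = j - 1\<close> the extended summand vanishes through its
        weight, whatever the value of \<open>filling_ext\<close>.\<close>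
      moreover have "real m = real j - 1" if "\<not> m < j - 1"
      proof -
        have "j = m + 1" using that False by simp
        then show ?thesis by simp
      qed
      ultimately show ?thesis by simp
    qed
  qed
  also have "\<dots> = (\<Sum>m\<le>n. ?g m) - (\<Sum>m<j-1. ?g m)"
  proof -
    have "(\<Sum>m\<le>n. if m < j - 1 then ?g m else 0) = (\<Sum>m<j-1. ?g m)"
      using assms by (intro sum.mono_neutral_cong_right) auto
    moreover have "(\<Sum>m\<le>n. if m < j - 1 then 0 else ?g m) =
        (\<Sum>m\<le>n. ?g m) - (\<Sum>m\<le>n. if m < j - 1 then ?g m else 0)"
      unfolding sum_subtractf[symmetric] by (intro sum.cong) auto
    ultimately show ?thesis by (simp only:)
  qed
  also have "(\<Sum>m\<le>n. ?g m) = N * ((real j + 1) / (2 * real j) * (real n + 1) ^ (n - 1))"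
    using sum_filling_ext[OF assms] by (simp only: N_def)
  also have "(\<Sum>m<j-1. ?g m) =
      - (N * (\<Sum>m<j-1. real (n choose m) * real (j - 1 - m) * N ^ (n - m - 1) * filling_ext j m))"
    unfolding sum_distrib_left sum_negf[symmetric]
  proof (intro sum.cong refl)
    fix m assume "m \<in> {..<j-1}"
    then have m: "m < j - 1" by simp
    have "real m - (real j - 1) = - real (j - 1 - m)" using m by (simp add: of_nat_diff)
    moreover have "N ^ (n - m) = N * N ^ (n - m - 1)"
    proof -
      have "n - m = Suc (n - m - 1)" using m assms by arith
      then show ?thesis by (metis power_Suc)
    qed
    ultimately show "?g m = - (N * (real (n choose m) * real (j - 1 - m) * N ^ (n - m - 1) * filling_ext j m))"
      by (simp only: mult_ac mult_minus_left mult_minus_right)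
  qed
  finally have "N * real (num_lucky_spot n j) = N * ((real j + 1) / (2 * real j) * (real n + 1) ^ (n - 1) +
      (\<Sum>m<j-1. real (n choose m) * real (j - 1 - m) * N ^ (n - m - 1) * filling_ext j m))"
    by (simp add: distrib_left)
  then show ?thesis using N by (simp add: N_def)
qed

section \<open>Evaluation for j = 3, 4, 5\<close>

lemma real_choose_Suc:
  "real (n choose Suc k) = real (n choose k) * (real n - real k) / (real k + 1)"
proof (cases "k \<le> n")
  case True
  have "Suc k * (n choose Suc k) = (n choose k) * (n - k)"
    using binomial_absorb_comp[of n k] binomial_absorption[of k n] by (simp add: mult.commute)
  then have "real (Suc k) * real (n choose Suc k) = real (n choose k) * real (n - k)"
    by (metis of_nat_mult)
  then show ?thesis using True by (simp add: of_nat_diff field_simps)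
qed (simp add: binomial_eq_0)

lemma real_choose_2: "real (n choose 2) = real n * (real n - 1) / 2"
  by (simp add: numeral_eq_Suc real_choose_Suc)

lemma real_choose_3: "real (n choose 3) = real n * (real n - 1) * (real n - 2) / 6"
  by (simp add: numeral_eq_Suc real_choose_Suc)

text \<open>The finite correction is evaluated at each \<open>m < j - 1\<close>, the smallest power
  of \<open>N\<close> is factored out, and a polynomial identity in \<open>n\<close> remains. The
  same scheme serves \<open>j = 4\<close> and \<open>j = 5\<close>.\<close>

lemma num_lucky_spot_3:
  assumes "3 \<le> n"
  shows "real (num_lucky_spot n 3) = 2/3 * (real n + 1) ^ (n - 1)
      - 1/3 * (2 * real n - 1) * (real n - 2) ^ (n - 2)"
proof -
  \<comment> \<open>For \<open>m < k\<close> the binomial coefficient is zero, so the truncated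
    exponent \<open>m - k\<close> does no harm.\<close>
  have f: "filling_ext 3 0 = -1/12" "filling_ext 3 (Suc 0) = -1/2"
    by (simp_all add: filling_ext_def numeral_eq_Suc)
  define N where "N = real n - 2"
  have p: "N ^ (n - Suc 0) = N * N ^ (n - 2)" "N ^ (n - Suc 1) = N ^ (n - 2)"
    using assms by (auto simp: le_iff_add numeral_eq_Suc)
  have "real (num_lucky_spot n 3) = 2/3 * (real n + 1) ^ (n - 1) +
    (\<Sum>m<2. real (n choose m) * real (2 - m) * N ^ (n - m - 1) * filling_ext 3 m)"
    using num_lucky_spot_formula[of 3 n] assms by (simp add: N_def)
  also have "(\<Sum>m<2. real (n choose m) * real (2 - m) * N ^ (n - m - 1) * filling_ext 3 m) =
    (2 * N * (-1/12) + real n * (-1/2)) * N ^ (n - 2)"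
    using p by (simp add: lessThan_nat_numeral f field_simps)
  also have "2 * N * (-1/12) + real n * (-1/2) = - (1/3 * (2 * real n - 1))"
    by (simp add: N_def power2_eq_square power3_eq_cube field_simps)
  finally show ?thesis by (simp add: N_def)
qed

lemma num_lucky_spot_4:
  assumes "4 \<le> n"
  shows "real (num_lucky_spot n 4) = 5/8 * (real n + 1) ^ (n - 1)
      - 1/8 * (13 * real n ^ 2 - 26 * real n + 9) * (real n - 3) ^ (n - 3)"
proof -
  have f: "filling_ext 4 0 = -1/24" "filling_ext 4 (Suc 0) = -1/4" "filling_ext 4 2 = -2"
    by (simp_all add: filling_ext_def numeral_eq_Suc)
  define N where "N = real n - 3"
  have p: "N ^ (n - Suc 0) = N ^ 2 * N ^ (n - 3)" "N ^ (n - Suc 1) = N * N ^ (n - 3)"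
    "N ^ (n - Suc 2) = N ^ (n - 3)"
    using assms by (auto simp: le_iff_add numeral_eq_Suc)
  have "real (num_lucky_spot n 4) = 5/8 * (real n + 1) ^ (n - 1) +
    (\<Sum>m<3. real (n choose m) * real (3 - m) * N ^ (n - m - 1) * filling_ext 4 m)"
    using num_lucky_spot_formula[of 4 n] assms by (simp add: N_def)
  also have "(\<Sum>m<3. real (n choose m) * real (3 - m) * N ^ (n - m - 1) * filling_ext 4 m) =
    (3 * N ^ 2 * (-1/24) + real n * 2 * N * (-1/4)
      + (real n * (real n - 1) / 2) * (-2)) * N ^ (n - 3)"
    using p by (simp add: lessThan_nat_numeral f real_choose_2 field_simps)
  also have "3 * N ^ 2 * (-1/24) + real n * 2 * N * (-1/4)
      + (real n * (real n - 1) / 2) * (-2) =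
    - (1/8 * (13 * real n ^ 2 - 26 * real n + 9))"
    by (simp add: N_def power2_eq_square power3_eq_cube field_simps)
  finally show ?thesis by (simp add: N_def)
qed

lemma num_lucky_spot_5:
  assumes "5 \<le> n"
  shows "real (num_lucky_spot n 5) = 3/5 * (real n + 1) ^ (n - 1)
      - 1/30 * (118 * real n ^ 3 - 531 * real n ^ 2 + 659 * real n - 192) * (real n - 4) ^ (n - 4)"
proof -
  have f: "filling_ext 5 0 = -1/40" "filling_ext 5 (Suc 0) = -1/6"
    "filling_ext 5 2 = -5/4" "filling_ext 5 3 = -25/2"
    by (simp_all add: filling_ext_def numeral_eq_Suc)
  define N where "N = real n - 4"
  have p: "N ^ (n - Suc 0) = N ^ 3 * N ^ (n - 4)" "N ^ (n - Suc 1) = N ^ 2 * N ^ (n - 4)"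
    "N ^ (n - Suc 2) = N * N ^ (n - 4)" "N ^ (n - Suc 3) = N ^ (n - 4)"
    using assms by (auto simp: le_iff_add numeral_eq_Suc)
  have "real (num_lucky_spot n 5) = 3/5 * (real n + 1) ^ (n - 1) +
    (\<Sum>m<4. real (n choose m) * real (4 - m) * N ^ (n - m - 1) * filling_ext 5 m)"
    using num_lucky_spot_formula[of 5 n] assms by (simp add: N_def)
  \<comment> \<open>The summands \<open>m = 0, 1, 2, 3\<close> carry weights 4, 3, 2, 1 and, once
    \<open>N ^ (n - 4)\<close> is pulled out, the powers \<open>N ^ (3 - m)\<close>.\<close>
  also have "(\<Sum>m<4. real (n choose m) * real (4 - m) * N ^ (n - m - 1) * filling_ext 5 m) =
    (4 * N ^ 3 * (-1/40) + real n * 3 * N ^ 2 * (-1/6)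
      + (real n * (real n - 1) / 2) * 2 * N * (-5/4)
      + (real n * (real n - 1) * (real n - 2) / 6) * (-25/2)) * N ^ (n - 4)"
    using p by (simp add: lessThan_nat_numeral f real_choose_2 real_choose_3 field_simps)
  also have "4 * N ^ 3 * (-1/40) + real n * 3 * N ^ 2 * (-1/6)
      + (real n * (real n - 1) / 2) * 2 * N * (-5/4)
      + (real n * (real n - 1) * (real n - 2) / 6) * (-25/2) =
    - (1/30 * (118 * real n ^ 3 - 531 * real n ^ 2 + 659 * real n - 192))"
    by (simp add: N_def power2_eq_square power3_eq_cube field_simps)
  finally show ?thesis by (simp add: N_def)
qed

theorem mainTheorem8:
  fixes n :: nat
  shows "(n \<ge> 3 \<longrightarrow>
            num_lucky_spot n 3 = (\<Sum>i=1..n. q n i 3) \<and>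
            real (\<Sum>i=1..n. q n i 3) =
              2/3 * (real n + 1) ^ (n - 1)
              - 1/3 * (2 * real n - 1) * (real n - 2) ^ (n - 2)) \<and>
         (n \<ge> 4 \<longrightarrow>
            num_lucky_spot n 4 = (\<Sum>i=1..n. q n i 4) \<and>
            real (\<Sum>i=1..n. q n i 4) =
              5/8 * (real n + 1) ^ (n - 1)
              - 1/8 * (13 * real n ^ 2 - 26 * real n + 9) * (real n - 3) ^ (n - 3)) \<and>
         (n \<ge> 5 \<longrightarrow>
            num_lucky_spot n 5 = (\<Sum>i=1..n. q n i 5) \<and>
            real (\<Sum>i=1..n. q n i 5) =
              3/5 * (real n + 1) ^ (n - 1)
              - 1/30 * (118 * real n ^ 3 - 531 * real n ^ 2 + 659 * real n - 192)
                  * (real n - 4) ^ (n - 4))"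
  using num_lucky_spot_3 num_lucky_spot_4 num_lucky_spot_5
  by (simp only: num_lucky_spot_eq_sum_q[symmetric] simp_thms) blast

end
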